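(* Let $0<k<m$ and let $\phi\colon\mathbb{F}_2^{m+k}\to\mathbb{F}_2^{m-k}$ be a mapping such that $D_vD_w\phi\neq0_{m-k}$ (i.e., $D_vD_w\phi$ is not identically zero) for all linearly independent $v,w\in\mathbb{F}_2^{m+k}$. Let $h\colon\mathbb{F}_2^{m+k}\to\mathbb{F}_2$ be a Boolean function and define $f(x,y)=x\cdot\phi(y)+h(y)$ on $\mathbb{F}_2^{2m}$, where $x\in\mathbb{F}_2^{m-k}$, $y\in\mathbb{F}_2^{m+k}$. Then every $\mathcal{M}$-subspace $V$ of $f$ satisfies $\dim(V)\le m-k$. Furthermore, $V=\mathbb{F}_2^{m-k}\times\{0_{m+k}\}$ is the unique $\mathcal{M}$-subspace of $f$ of maximal dimension $m-k$ if and only if there do not exist a nonzero $b_2\in\mathbb{F}_2^{m+k}$ and an $(m-k-1)$-dimensional subspace $U$ of $\mathbb{F}_2^{m-k}$ such that $u\cdot D_{b_2}\phi(y)=0$ for all $u\in U$ and all $y\in\mathbb{F}_2^{m+k}$. In particular, when $f$ is bent, $f$ is outside $\mathcal{M}^{\#}$.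
   Context: "$\cdot$" is the standard dot product over $\mathbb{F}_2$; $0_r$ is the zero vector of $\mathbb{F}_2^r$. For a (vectorial) function $F$ on $\mathbb{F}_2^n$, $D_aF(x)=F(x+a)+F(x)$ and $D_aD_bF(x)=F(x)+F(x+a)+F(x+b)+F(x+a+b)$. A vector subspace $V\subseteq\mathbb{F}_2^n$ is an $\mathcal{M}$-subspace of $f\colon\mathbb{F}_2^n\to\mathbb{F}_2$ if $D_aD_bf=0$ identically for all $a,b\in V$. For $n$ even, $f\colon\mathbb{F}_2^n\to\mathbb{F}_2$ is bent if $\sum_{x\in\mathbb{F}_2^n}(-1)^{f(x)+\omega\cdot x}=\pm2^{n/2}$ for all $\omega\in\mathbb{F}_2^n$. The Maiorana-McFarland class $\mathcal{M}$ in $n=2m$ variables is the set of functions $f(x,y)=x\cdot\pi(y)+g(y)$, $x,y\in\mathbb{F}_2^{m}$, with $\pi$ a permutation of $\mathbb{F}_2^{m}$ and $g$ an arbitrary Boolean function on $\mathbb{F}_2^m$. The completed class $\mathcal{M}^{\#}$ is the set of all functions $z\mapsto f(zA+b)+c\cdot z+d$ with $f\in\mathcal{M}$, $A\in GL(n,\mathbb{F}_2)$, $b,c\in\mathbb{F}_2^n$, $d\in\mathbb{F}_2$. *)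

theory Defs
  imports "HOL-Library.Z2" "HOL-Library.FuncSet" "Jordan_Normal_Form.VS_Connect"
begin

text \<open>
  The space \<open>\<bbbF>\<^sub>2\<^sup>n\<close> is \<^term>\<open>carrier_vec n :: bit vec set\<close>, with vector space structure
  \<^term>\<open>module_vec TYPE(bit) n\<close>. Functions on \<open>\<bbbF>\<^sub>2\<^sup>n\<close> are HOL functions on \<^typ>\<open>bit vec\<close> of
  which only the values on \<^term>\<open>carrier_vec n\<close> matter. The pair \<open>(x, y)\<close> is the concatenation
  \<open>x @\<^sub>v y\<close>.
\<close>

abbreviation subspace_F2 :: "nat \<Rightarrow> bit vec set \<Rightarrow> bool" where
  "subspace_F2 n V \<equiv> subspace class_ring V (module_vec TYPE(bit) n)"

abbreviation dim_F2 :: "nat \<Rightarrow> bit vec set \<Rightarrow> nat" where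
  "dim_F2 n V \<equiv> vectorspace.dim class_ring (module_vec TYPE(bit) n \<lparr>carrier := V\<rparr>)"

text \<open>The library notion is a property of the set \<^term>\<open>{v, w}\<close>, hence the conjunct
  \<^term>\<open>v \<noteq> w\<close>.\<close>

definition lin_indpt_pair :: "nat \<Rightarrow> bit vec \<Rightarrow> bit vec \<Rightarrow> bool" where
  "lin_indpt_pair n v w \<longleftrightarrow>
     v \<noteq> w \<and> \<not> LinearCombinations.module.lin_dep class_ring (module_vec TYPE(bit) n) {v, w}"

definition derivative :: "bit vec \<Rightarrow> (bit vec \<Rightarrow> 'b::plus) \<Rightarrow> bit vec \<Rightarrow> 'b" where
  "derivative a F x = F (x + a) + F x"

definition M_subspace :: "nat \<Rightarrow> (bit vec \<Rightarrow> bit) \<Rightarrow> bit vec set \<Rightarrow> bool" where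
  "M_subspace n f V \<longleftrightarrow> subspace_F2 n V \<and>
     (\<forall>a\<in>V. \<forall>b\<in>V. \<forall>x\<in>carrier_vec n. derivative a (derivative b f) x = 0)"

definition sign_bit :: "bit \<Rightarrow> int" where
  "sign_bit b = (if b = 0 then 1 else -1)"

definition bent :: "nat \<Rightarrow> (bit vec \<Rightarrow> bit) \<Rightarrow> bool" where
  "bent n f \<longleftrightarrow> even n \<and>
     (\<forall>\<omega>\<in>carrier_vec n.
        (\<Sum>x\<in>carrier_vec n. sign_bit (f x + \<omega> \<bullet> x)) \<in> {2 ^ (n div 2), - (2 ^ (n div 2))})"

definition MM_class :: "nat \<Rightarrow> (bit vec \<Rightarrow> bit) set" where
  "MM_class m = {f. \<exists>\<pi> g. bij_betw \<pi> (carrier_vec m) (carrier_vec m) \<and>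
     (\<forall>x\<in>carrier_vec m. \<forall>y\<in>carrier_vec m. f (x @\<^sub>v y) = x \<bullet> \<pi> y + g y)}"

text \<open>The row vector \<open>z A\<close> is the column vector \<open>A\<^sup>T z\<close>.\<close>

definition MM_completed :: "nat \<Rightarrow> (bit vec \<Rightarrow> bit) set" where
  "MM_completed m = {F. \<exists>f\<in>MM_class m. \<exists>A\<in>carrier_mat (2 * m) (2 * m). invertible_mat A \<and>
     (\<exists>b\<in>carrier_vec (2 * m). \<exists>c\<in>carrier_vec (2 * m). \<exists>d.
        \<forall>z\<in>carrier_vec (2 * m). F z = f (transpose_mat A *\<^sub>v z + b) + c \<bullet> z + d)}"

end

theory Submission
  imports Defs
begin

text \<open>
  For \<open>a = (a\<^sub>1, a\<^sub>2)\<close> and \<open>b = (b\<^sub>1, b\<^sub>2)\<close> the second derivative of \<open>f\<close> is affine in \<open>x\<close> with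
  linear coefficient \<open>D\<^sub>a\<^sub>2 D\<^sub>b\<^sub>2 \<phi>\<close>, so the second components of an \<open>M\<close>-subspace \<open>V\<close> span at most
  a line \<open>{0, b\<^sub>2}\<close>. If \<open>b\<^sub>2 \<noteq> 0\<close> occurs, \<open>V\<close> is the union of \<open>U \<times> {0}\<close> and one more coset, where
  \<open>U\<close> is orthogonal to all values of \<open>D\<^sub>b\<^sub>2 \<phi>\<close>. Then \<open>U\<close> is proper, since otherwise \<open>D\<^sub>b\<^sub>2 \<phi> = 0\<close>
  and all \<open>D\<^sub>w D\<^sub>b\<^sub>2 \<phi>\<close> vanish. Finally, a function in the completed class has an
  \<open>M\<close>-subspace of dimension \<open>m > m - k\<close>, the preimage of \<open>\<bbbF>\<^sub>2\<^sup>m \<times> {0}\<close> under the linear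
  substitution. Dimensions are compared by counting: a subspace of dimension \<open>d\<close> has \<open>2\<^sup>d\<close> elements.
\<close>

text \<open>These rules rewrite \<open>+\<close> and \<open>*\<close> on \<^typ>\<open>bit\<close> to bitwise operations, out of reach of the
  field lemmas.\<close>

declare add_bit_eq_xor [simp del] mult_bit_eq_and [simp del]

section \<open>Cardinality and dimension\<close>

text \<open>Coordinates with respect to a finite basis \<open>B\<close> give the bijection: each
  vector is a linear combination with exactly one coefficient function. Taking these functions
  extensional on \<open>B\<close> is what makes them unique.\<close>

lemma (in vectorspace) card_carrier:
  assumes "fin_dim"
  shows "card (carrier V) = card (carrier K) ^ dim"
proof -
  obtain B where B: "finite B" "basis B"
    using finite_basis_exists[OF assms] by blast
  then have BV: "B \<subseteq> carrier V" by (simp add: basis_def)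
  have "bij_betw (\<lambda>a. lincomb a B) (B \<rightarrow>\<^sub>E carrier K) (carrier V)"
    unfolding bij_betw_def
  proof
    have crit: "\<exists>!a. a \<in> B \<rightarrow>\<^sub>E carrier K \<and> lincomb a B = v" if "v \<in> carrier V" for v
      using basis_criterion[OF B(1) BV] B(2) that by blast
    have closed: "lincomb a B \<in> carrier V" if "a \<in> B \<rightarrow>\<^sub>E carrier K" for a
      using that BV by (intro lincomb_closed) auto
    show "inj_on (\<lambda>a. lincomb a B) (B \<rightarrow>\<^sub>E carrier K)"
      using crit closed by (intro inj_onI) metis
    show "(\<lambda>a. lincomb a B) ` (B \<rightarrow>\<^sub>E carrier K) = carrier V"
      using crit closed by (auto simp: image_iff) metis
  qed
  then have "card (carrier V) = card (B \<rightarrow>\<^sub>E carrier K)"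
    by (simp add: bij_betw_same_card)
  then show ?thesis
    using B by (simp add: card_funcsetE dim_basis)
qed

section \<open>Vectors and subspaces over the field with two elements\<close>

lemma bit_vec_add_self: "x + x = 0\<^sub>v n" if "x \<in> carrier_vec n" for x :: "bit vec"
  using that by (intro eq_vecI) auto

lemma bit_vec_add_eq_zero_iff:
  "x + y = 0\<^sub>v n \<longleftrightarrow> x = y" if "x \<in> carrier_vec n" "y \<in> carrier_vec n" for x y :: "bit vec"
proof
  assume "x + y = 0\<^sub>v n"
  then have "x $ i + y $ i = 0" if "i < n" for i
    using that \<open>y \<in> _\<close> by (metis carrier_vecD index_add_vec(1) index_zero_vec(1))
  then have "x $ i = y $ i" if "i < n" for i
    using that by (cases "x $ i"; cases "y $ i") force+
  then show "x = y" using that by (intro eq_vecI) auto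
qed (use that in \<open>simp add: bit_vec_add_self\<close>)

lemma card_UNIV_bit: "card (UNIV :: bit set) = 2"
proof -
  have "(UNIV :: bit set) = {0, 1}" by (auto intro: bit_not_zero_iff[THEN iffD1])
  then show ?thesis by (metis card_2_iff zero_neq_one)
qed

lemma card_carrier_vec_bit: "card (carrier_vec n :: bit vec set) = 2 ^ n"
proof -
  interpret vec_space "TYPE(bit)" n .
  show ?thesis using card_carrier dim_is_n by (simp add: card_UNIV_bit)
qed

lemma finite_carrier_vec_bit [simp]: "finite (carrier_vec n :: bit vec set)"
  by (rule card_ge_0_finite) (simp add: card_carrier_vec_bit)

text \<open>The only scalars are 0 and 1, so closure under scalar multiplication follows from
  containing zero.\<close>

lemma subspace_F2_iff:
  "subspace_F2 n V \<longleftrightarrow> V \<subseteq> carrier_vec n \<and> 0\<^sub>v n \<in> V \<and> (\<forall>a\<in>V. \<forall>b\<in>V. a + b \<in> V)"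
proof -
  interpret vec_space "TYPE(bit)" n .
  have smult: "c \<cdot>\<^sub>v x \<in> V" if "V \<subseteq> carrier_vec n" "0\<^sub>v n \<in> V" "x \<in> V" for c :: bit and x
  proof (cases c rule: bit.exhaust)
    case zero
    have "x \<in> carrier_vec n" using that by auto
    then have "c \<cdot>\<^sub>v x = 0\<^sub>v n" using zero by (intro eq_vecI) auto
    then show ?thesis using that by simp
  qed (use that in simp)
  show ?thesis
    unfolding VectorSpace.subspace_def submodule_def
    using smult vec_vs[where 'a = bit, of n] module_axioms
    by (auto simp: module_vec_simps)
qed

text \<open>This turns every comparison of dimensions into counting. Finite dimension holds because
  \<open>V\<close> is finite and spans itself.\<close>

lemma card_subspace_F2: "card V = 2 ^ dim_F2 n V" if "subspace_F2 n V"
proof -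
  let ?M = "module_vec TYPE(bit) n\<lparr>carrier := V\<rparr>"
  interpret W: vec_space "TYPE(bit)" n .
  interpret vectorspace class_ring ?M
    using W.subspace_is_vs[OF that] .
  have V: "V \<subseteq> carrier_vec n" using that by (simp add: subspace_F2_iff)
  then have "finite V" by (rule finite_subset) simp
  moreover have "span V = V"
    using in_own_span[of V] span_is_subset2[of V] by auto
  ultimately have "fin_dim" unfolding fin_dim_def by auto
  from card_carrier[OF this] show ?thesis by (simp add: card_UNIV_bit)
qed

lemma dim_F2_eqI: "dim_F2 n V = d" if "subspace_F2 n V" "card V = 2 ^ d"
  using card_subspace_F2[OF that(1)] that(2) by simp

text \<open>A nontrivial relation has coefficients (1,0), (0,1) or (1,1), which would force
  \<open>v\<close> to be zero, \<open>w\<close> to be zero, or both to be equal.\<close>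

lemma lin_indpt_pairI:
  assumes "v \<in> carrier_vec n" "w \<in> carrier_vec n" "v \<noteq> 0\<^sub>v n" "w \<noteq> 0\<^sub>v n" "v \<noteq> w"
  shows "lin_indpt_pair n v w"
proof -
  interpret vec_space "TYPE(bit)" n .
  have "\<not> lin_dep {v, w}"
  proof
    assume "lin_dep {v, w}"
    from finite_lin_dep[OF _ this] assms obtain a x where
      a: "lincomb a {v, w} = 0\<^sub>v n" "x \<in> {v, w}" "a x \<noteq> 0" by auto
    have "lincomb a {v, w} = a v \<cdot>\<^sub>v v + a w \<cdot>\<^sub>v w"
      using assms by (simp add: lincomb_def)
    with a(1) have eq: "a v \<cdot>\<^sub>v v + a w \<cdot>\<^sub>v w = 0\<^sub>v n" by simp
    have z: "0 \<cdot>\<^sub>v x = 0\<^sub>v n" if "x \<in> carrier_vec n" for x :: "bit vec"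
      using that by (intro eq_vecI) auto
    show False
      using eq a(2,3) assms
      by (cases "a v"; cases "a w") (auto simp: z bit_vec_add_eq_zero_iff)
  qed
  then show ?thesis using assms by (simp add: lin_indpt_pair_def)
qed


lemma scalar_prod_all_zero:
  assumes "w \<in> carrier_vec n" "\<And>x. x \<in> carrier_vec n \<Longrightarrow> x \<bullet> w = 0"
  shows "w = (0\<^sub>v n :: 'a :: semiring_1 vec)"
proof (intro eq_vecI)
  fix i assume "i < dim_vec (0\<^sub>v n :: 'a vec)"
  then show "w $ i = 0\<^sub>v n $ i"
    using assms(1) assms(2)[of "unit_vec n i"] by simp
qed (use assms in simp)

lemma derivative_zero:
  "derivative (0\<^sub>v n) F x = F x + F x" if "x \<in> carrier_vec n"
  using that by (simp add: derivative_def)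

lemma vec_add_minus_F2:
  "(x + y) + y = x" if "x \<in> carrier_vec n" "y \<in> carrier_vec n" for x y :: "bit vec"
  using that by (simp add: assoc_add_vec[of _ n] bit_vec_add_self)

lemma zero_append_vec: "0\<^sub>v (p + q) = 0\<^sub>v p @\<^sub>v 0\<^sub>v q"
  by (intro eq_vecI) auto

lemma embed_subspace:
  fixes U :: "bit vec set"
  assumes "subspace_F2 p U"
  shows "subspace_F2 (p + q) ((\<lambda>x. x @\<^sub>v 0\<^sub>v q) ` U)"
    and "dim_F2 (p + q) ((\<lambda>x. x @\<^sub>v 0\<^sub>v q) ` U) = dim_F2 p U"
proof -
  have U: "U \<subseteq> carrier_vec p" "0\<^sub>v p \<in> U" "\<And>a b. a \<in> U \<Longrightarrow> b \<in> U \<Longrightarrow> a + b \<in> U"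
    using assms by (auto simp: subspace_F2_iff)
  have "(a @\<^sub>v 0\<^sub>v q) + (b @\<^sub>v 0\<^sub>v q) = (a + b) @\<^sub>v 0\<^sub>v q" if "a \<in> U" "b \<in> U" for a b
    using that U(1) by (subst append_vec_add[of _ p _ _ q]) auto
  then show *: "subspace_F2 (p + q) ((\<lambda>x. x @\<^sub>v 0\<^sub>v q) ` U)"
    using U unfolding subspace_F2_iff by (auto simp: zero_append_vec intro!: append_carrier_vec)
  have "inj_on (\<lambda>x. x @\<^sub>v 0\<^sub>v q) U"
    using U(1) by (intro inj_onI) (subst (asm) append_vec_eq[of _ p], auto)
  then show "dim_F2 (p + q) ((\<lambda>x. x @\<^sub>v 0\<^sub>v q) ` U) = dim_F2 p U"
    by (intro dim_F2_eqI[OF *]) (simp add: card_image card_subspace_F2[OF assms])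
qed

lemma subspace_F2_carrier: "subspace_F2 n (carrier_vec n)" "dim_F2 n (carrier_vec n) = n"
proof -
  show *: "subspace_F2 n (carrier_vec n)" by (auto simp: subspace_F2_iff)
  show "dim_F2 n (carrier_vec n) = n"
    by (rule dim_F2_eqI[OF * card_carrier_vec_bit])
qed

lemma derivative_bit_zero [simp]:
  "x \<in> carrier_vec n \<Longrightarrow> derivative (0\<^sub>v n) F x = 0" for F :: "bit vec \<Rightarrow> bit"
  by (simp add: derivative_zero)

lemma derivative_vec_zero:
  "x \<in> carrier_vec n \<Longrightarrow> F x \<in> carrier_vec k \<Longrightarrow> derivative (0\<^sub>v n) F x = 0\<^sub>v k"
  for F :: "bit vec \<Rightarrow> bit vec"
  by (simp add: derivative_zero bit_vec_add_self)

section \<open>Functions that are affine in the first block of variables\<close>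

text \<open>The block lengths \<open>p\<close> and \<open>q\<close> are independent so that both the
  function of the theorem (\<open>m - k\<close> and \<open>m + k\<close>) and the members of
  \<open>MM_class m\<close> (\<open>m\<close> and \<open>m\<close>) are instances.\<close>

locale affine_first_block =
  fixes p q :: nat and \<phi> :: "bit vec \<Rightarrow> bit vec" and h f :: "bit vec \<Rightarrow> bit"
  assumes \<phi>_closed [simp]: "\<And>y. y \<in> carrier_vec q \<Longrightarrow> \<phi> y \<in> carrier_vec p"
    and f_eq: "\<And>x y. x \<in> carrier_vec p \<Longrightarrow> y \<in> carrier_vec q \<Longrightarrow> f (x @\<^sub>v y) = x \<bullet> \<phi> y + h y"
begin

lemma derivative_\<phi>_closed [simp]:
  "y \<in> carrier_vec q \<Longrightarrow> a \<in> carrier_vec q \<Longrightarrow> derivative a \<phi> y \<in> carrier_vec p"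
  by (simp add: derivative_def)

text \<open>Expanding the four values bilinearly and cancelling in characteristic two isolates the
  part linear in \<open>x\<close>. The terms with \<open>a\<^sub>1\<close> occur only at the points
  shifted by \<open>a\<^sub>2\<close>, and those with \<open>b\<^sub>1\<close> only at the points
  shifted by \<open>b\<^sub>2\<close>.\<close>

lemma second_derivative:
  assumes [simp]: "x \<in> carrier_vec p" "a\<^sub>1 \<in> carrier_vec p" "b\<^sub>1 \<in> carrier_vec p"
    "y \<in> carrier_vec q" "a\<^sub>2 \<in> carrier_vec q" "b\<^sub>2 \<in> carrier_vec q"
  shows "derivative (a\<^sub>1 @\<^sub>v a\<^sub>2) (derivative (b\<^sub>1 @\<^sub>v b\<^sub>2) f) (x @\<^sub>v y) =
    x \<bullet> derivative a\<^sub>2 (derivative b\<^sub>2 \<phi>) y + a\<^sub>1 \<bullet> derivative b\<^sub>2 \<phi> (y + a\<^sub>2)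
    + b\<^sub>1 \<bullet> derivative a\<^sub>2 \<phi> (y + b\<^sub>2) + derivative a\<^sub>2 (derivative b\<^sub>2 h) y"
proof -
  have add: "(u @\<^sub>v v) + (u' @\<^sub>v v') = (u + u') @\<^sub>v (v + v')"
    if "u \<in> carrier_vec p" "u' \<in> carrier_vec p" "v \<in> carrier_vec q" "v' \<in> carrier_vec q"
    for u u' v v' :: "bit vec"
    using that by (intro append_vec_add)
  have comm: "y + b\<^sub>2 + a\<^sub>2 = y + a\<^sub>2 + b\<^sub>2"
    by (simp add: assoc_add_vec[of _ q] comm_add_vec[of a\<^sub>2 q])
  have cancel: "c + c = 0" "c + (c + d) = d" for c d :: bit
    by (cases c; cases d; simp)+
  show ?thesis
    unfolding derivative_def
    by (simp add: add f_eq comm add_scalar_prod_distrib[of _ p] scalar_prod_add_distrib[of _ p]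
        ac_simps cancel)
qed

lemma second_derivative_left:
  assumes [simp]: "u \<in> carrier_vec p" "x \<in> carrier_vec p" "b\<^sub>1 \<in> carrier_vec p"
    "y \<in> carrier_vec q" "b\<^sub>2 \<in> carrier_vec q"
  shows "derivative (u @\<^sub>v 0\<^sub>v q) (derivative (b\<^sub>1 @\<^sub>v b\<^sub>2) f) (x @\<^sub>v y) = u \<bullet> derivative b\<^sub>2 \<phi> y"
  by (simp add: second_derivative derivative_vec_zero[of _ q _ p])

lemma M_subspace_append_iff:
  "M_subspace (p + q) f V \<longleftrightarrow> subspace_F2 (p + q) V \<and>
    (\<forall>a\<in>V. \<forall>b\<in>V. \<forall>x\<in>carrier_vec p. \<forall>y\<in>carrier_vec q. derivative a (derivative b f) (x @\<^sub>v y) = 0)"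
  unfolding M_subspace_def all_vec_append by blast

text \<open>Both directions have second component zero, so only a derivative of \<phi> in direction
  zero remains.\<close>

lemma M_subspace_left:
  "M_subspace (p + q) f ((\<lambda>x. x @\<^sub>v 0\<^sub>v q) ` carrier_vec p)"
  "dim_F2 (p + q) ((\<lambda>x. x @\<^sub>v 0\<^sub>v q) ` carrier_vec p) = p"
  using embed_subspace[OF subspace_F2_carrier(1)] subspace_F2_carrier(2)
  by (auto simp: M_subspace_append_iff second_derivative_left derivative_vec_zero[of _ q _ p])

end

section \<open>Structure and maximal dimension of \<open>M_subspace\<close> sets when second
  derivatives of \<phi> in independent directions are nonzero\<close>

locale independent_second_derivatives = affine_first_block +
  assumes indpt: "\<And>v w. v \<in> carrier_vec q \<Longrightarrow> w \<in> carrier_vec q \<Longrightarrow> lin_indpt_pair q v w \<Longrightarrow>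
      \<exists>y\<in>carrier_vec q. derivative v (derivative w \<phi>) y \<noteq> 0\<^sub>v p"
    and q_ge_2: "q \<ge> 2"
begin

text \<open>Distinct nonzero second components are independent, so at some \<open>y\<close> the
  second derivative of \<open>f\<close> is affine in \<open>x\<close> with nonzero linear part and
  cannot vanish for all \<open>x\<close>.\<close>

lemma second_components_eq:
  assumes V: "M_subspace (p + q) f V" and ab: "a\<^sub>1 @\<^sub>v a\<^sub>2 \<in> V" "b\<^sub>1 @\<^sub>v b\<^sub>2 \<in> V"
    and [simp]: "a\<^sub>1 \<in> carrier_vec p" "b\<^sub>1 \<in> carrier_vec p" "a\<^sub>2 \<in> carrier_vec q" "b\<^sub>2 \<in> carrier_vec q"
    and nz: "a\<^sub>2 \<noteq> 0\<^sub>v q" "b\<^sub>2 \<noteq> 0\<^sub>v q"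
  shows "a\<^sub>2 = b\<^sub>2"
proof (rule ccontr)
  assume "a\<^sub>2 \<noteq> b\<^sub>2"
  then obtain y where y: "y \<in> carrier_vec q" "derivative a\<^sub>2 (derivative b\<^sub>2 \<phi>) y \<noteq> 0\<^sub>v p"
    using indpt[of a\<^sub>2 b\<^sub>2] lin_indpt_pairI nz by auto
  have closed: "derivative a\<^sub>2 (derivative b\<^sub>2 \<phi>) y \<in> carrier_vec p"
    using y(1) by (simp add: derivative_def)
  let ?c = "a\<^sub>1 \<bullet> derivative b\<^sub>2 \<phi> (y + a\<^sub>2) + b\<^sub>1 \<bullet> derivative a\<^sub>2 \<phi> (y + b\<^sub>2)
    + derivative a\<^sub>2 (derivative b\<^sub>2 h) y"
  have eq: "x \<bullet> derivative a\<^sub>2 (derivative b\<^sub>2 \<phi>) y + ?c = 0" if "x \<in> carrier_vec p" for x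
    using V ab that y(1) second_derivative[of x a\<^sub>1 b\<^sub>1 y a\<^sub>2 b\<^sub>2]
    by (simp add: M_subspace_append_iff add.assoc)
  \<comment> \<open>Evaluating at \<open>x = 0\<close> removes the linear part.\<close>
  have "?c = 0"
    using eq[of "0\<^sub>v p"] closed by simp
  then have "x \<bullet> derivative a\<^sub>2 (derivative b\<^sub>2 \<phi>) y = 0" if "x \<in> carrier_vec p" for x
    using eq[OF that] by (simp only: add_0_right)
  then show False
    using scalar_prod_all_zero[OF closed] y(2) by blast
qed

text \<open>If \<open>U\<close> were the whole space, the derivative of \<phi> along
  \<open>b\<close> would vanish identically, and with it every further derivative, contradicting
  \<open>indpt\<close>.\<close>

lemma dim_annihilator_less:
  assumes U: "subspace_F2 p U" and b: "b \<in> carrier_vec q" "b \<noteq> 0\<^sub>v q"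
    and perp: "\<And>u y. u \<in> U \<Longrightarrow> y \<in> carrier_vec q \<Longrightarrow> u \<bullet> derivative b \<phi> y = 0"
  shows "dim_F2 p U < p"
proof (rule ccontr)
  assume "\<not> dim_F2 p U < p"
  then have "card (carrier_vec p :: bit vec set) \<le> card U"
    by (simp add: card_subspace_F2[OF U] card_carrier_vec_bit)
  then have "U = carrier_vec p"
    using U by (intro card_seteq) (auto simp: subspace_F2_iff)
  then have zero: "derivative b \<phi> y = 0\<^sub>v p" if "y \<in> carrier_vec q" for y
    using perp that b by (intro scalar_prod_all_zero) auto
  \<comment> \<open>At least four vectors exist, so some \<open>w\<close> avoids both zero and
    \<open>b\<close> and is independent of \<open>b\<close>.\<close>
  have "(2::nat) ^ 2 \<le> 2 ^ q" using q_ge_2 by (intro power_increasing) auto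
  then have "\<not> (carrier_vec q :: bit vec set) \<subseteq> {0\<^sub>v q, b}"
    using card_mono[of "{0\<^sub>v q, b}" "carrier_vec q"] b by (auto simp: card_carrier_vec_bit)
  then obtain w where w: "w \<in> carrier_vec q" "w \<noteq> 0\<^sub>v q" "w \<noteq> b" by blast
  then obtain y where "y \<in> carrier_vec q" "derivative w (derivative b \<phi>) y \<noteq> 0\<^sub>v p"
    using indpt[of w b] lin_indpt_pairI b by blast
  then show False
    using w(1) zero by (simp add: derivative_def[of w])
qed

text \<open>By \<open>second_components_eq\<close> at most one nonzero second component occurs. If
  there is one, \<open>V\<close> splits into two cosets of its part with second component zero,
  which doubles the cardinality and adds one to the dimension.\<close>

lemma M_subspace_cases:
  assumes V: "M_subspace (p + q) f V"
  obtains (left) "V \<subseteq> (\<lambda>x. x @\<^sub>v 0\<^sub>v q) ` carrier_vec p"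
  | (two_cosets) b\<^sub>2 U where "b\<^sub>2 \<in> carrier_vec q" "b\<^sub>2 \<noteq> 0\<^sub>v q" "subspace_F2 p U"
      "dim_F2 (p + q) V = Suc (dim_F2 p U)"
      "\<And>u y. u \<in> U \<Longrightarrow> y \<in> carrier_vec q \<Longrightarrow> u \<bullet> derivative b\<^sub>2 \<phi> y = 0"
proof (cases "V \<subseteq> (\<lambda>x. x @\<^sub>v 0\<^sub>v q) ` carrier_vec p")
  case False
  have sub: "subspace_F2 (p + q) V" using V by (simp add: M_subspace_def)
  then have closed: "\<And>a b. a \<in> V \<Longrightarrow> b \<in> V \<Longrightarrow> a + b \<in> V" and zero: "0\<^sub>v (p + q) \<in> V"
    and Vc: "V \<subseteq> carrier_vec (p + q)"
    by (auto simp: subspace_F2_iff)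
  have split: "\<exists>x\<in>carrier_vec p. \<exists>y\<in>carrier_vec q. a = x @\<^sub>v y" if "a \<in> V" for a
    using that Vc vec_first_last_append[of a p q] vec_first_carrier vec_last_carrier
    by (metis subsetD)
  from False obtain b where "b \<in> V" "b \<notin> (\<lambda>x. x @\<^sub>v 0\<^sub>v q) ` carrier_vec p" by blast
  with split[of b] obtain b\<^sub>1 b\<^sub>2 where b: "b\<^sub>1 @\<^sub>v b\<^sub>2 \<in> V" "b\<^sub>2 \<noteq> 0\<^sub>v q"
    and [simp]: "b\<^sub>1 \<in> carrier_vec p" "b\<^sub>2 \<in> carrier_vec q" by blast
  define U where "U = {u \<in> carrier_vec p. u @\<^sub>v 0\<^sub>v q \<in> V}"
  define E where "E = (\<lambda>x. x @\<^sub>v 0\<^sub>v q) ` U"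
  have add: "(u @\<^sub>v v) + (u' @\<^sub>v v') = (u + u') @\<^sub>v (v + v')"
    if "u \<in> carrier_vec p" "u' \<in> carrier_vec p" "v \<in> carrier_vec q" "v' \<in> carrier_vec q"
    for u u' v v' :: "bit vec"
    using that by (intro append_vec_add)
  have U: "subspace_F2 p U"
    unfolding subspace_F2_iff
  proof (intro conjI ballI)
    fix u v assume "u \<in> U" "v \<in> U"
    then show "u + v \<in> U"
      using closed[of "u @\<^sub>v 0\<^sub>v q" "v @\<^sub>v 0\<^sub>v q"] by (simp add: U_def add)
  qed (use zero zero_append_vec[where 'a = bit, of p q] in \<open>auto simp: U_def\<close>)
  have EV: "E \<subseteq> V" by (auto simp: E_def U_def)
  have bV: "b\<^sub>1 @\<^sub>v b\<^sub>2 \<in> carrier_vec (p + q)" by simp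
  \<comment> \<open>In characteristic two a translation is its own inverse.\<close>
  have inj: "inj_on (\<lambda>e. e + (b\<^sub>1 @\<^sub>v b\<^sub>2)) E"
    using EV Vc bV by (intro inj_on_inverseI[of _ "\<lambda>e. e + (b\<^sub>1 @\<^sub>v b\<^sub>2)"] vec_add_minus_F2) auto
  have V_eq: "V = E \<union> (\<lambda>e. e + (b\<^sub>1 @\<^sub>v b\<^sub>2)) ` E"
  proof (intro equalityI subsetI)
    fix a assume a: "a \<in> V"
    then obtain a\<^sub>1 a\<^sub>2 where [simp]: "a = a\<^sub>1 @\<^sub>v a\<^sub>2" "a\<^sub>1 \<in> carrier_vec p" "a\<^sub>2 \<in> carrier_vec q"
      using split by blast
    show "a \<in> E \<union> (\<lambda>e. e + (b\<^sub>1 @\<^sub>v b\<^sub>2)) ` E"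
    proof (cases "a\<^sub>2 = 0\<^sub>v q")
      case True
      then show ?thesis using a by (auto simp: E_def U_def)
    next
      case False
      then have eq: "a\<^sub>2 = b\<^sub>2"
        using second_components_eq[OF V, of a\<^sub>1 a\<^sub>2 b\<^sub>1 b\<^sub>2] a b by simp
      \<comment> \<open>The equal second components cancel, so the sum lies in the part of
        \<open>V\<close> described by \<open>U\<close>.\<close>
      have "a + (b\<^sub>1 @\<^sub>v b\<^sub>2) \<in> E"
        using closed[OF a b(1)] eq by (auto simp: E_def U_def add bit_vec_add_self[of _ q])
      moreover have "a = a + (b\<^sub>1 @\<^sub>v b\<^sub>2) + (b\<^sub>1 @\<^sub>v b\<^sub>2)"
        using vec_add_minus_F2[of a "p + q", OF _ bV] Vc a by auto
      ultimately show ?thesis by blast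
    qed
  qed (use EV closed b in auto)
  \<comment> \<open>The second components, zero and \<open>b\<^sub>2\<close>, tell the cosets
    apart.\<close>
  have disj: "E \<inter> (\<lambda>e. e + (b\<^sub>1 @\<^sub>v b\<^sub>2)) ` E = {}"
  proof -
    have "u @\<^sub>v 0\<^sub>v q \<noteq> (v @\<^sub>v 0\<^sub>v q) + (b\<^sub>1 @\<^sub>v b\<^sub>2)" if "u \<in> U" "v \<in> U" for u v
    proof -
      have "u \<in> carrier_vec p" "v \<in> carrier_vec p" using that by (auto simp: U_def)
      then show ?thesis using b(2) by (simp add: add append_vec_eq[of _ p])
    qed
    then show ?thesis unfolding E_def by blast
  qed
  have "finite E" using EV Vc by (meson finite_carrier_vec_bit finite_subset)
  then have "card V = 2 * card E"
    using disj inj by (subst V_eq) (simp add: card_Un_disjoint card_image)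
  also have "\<dots> = 2 ^ Suc (dim_F2 p U)"
    using embed_subspace[OF U, of q] card_subspace_F2[of E "p + q"] by (simp add: E_def)
  finally have "dim_F2 (p + q) V = Suc (dim_F2 p U)"
    by (rule dim_F2_eqI[OF sub])
  moreover have "u \<bullet> derivative b\<^sub>2 \<phi> y = 0" if "u \<in> U" "y \<in> carrier_vec q" for u y
  proof -
    have u: "u \<in> carrier_vec p" "u @\<^sub>v 0\<^sub>v q \<in> V" using that by (auto simp: U_def)
    then show ?thesis
      \<comment> \<open>Pairing \<open>(u, 0)\<close> with \<open>(b\<^sub>1, b\<^sub>2)\<close>
        gives a second derivative equal to this scalar product; \<open>x = 0\<close> is an arbitrary
        choice of point.\<close>
      using V b(1) that(2) second_derivative_left[of u "0\<^sub>v p" b\<^sub>1 y b\<^sub>2]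
      by (simp add: M_subspace_append_iff)
  qed
  ultimately show ?thesis using two_cosets[OF _ b(2) U] by simp
qed (rule left)

lemma dim_M_subspace_le:
  assumes V: "M_subspace (p + q) f V"
  shows "dim_F2 (p + q) V \<le> p"
  using V
proof (cases rule: M_subspace_cases)
  case left
  have sub: "subspace_F2 (p + q) V" using V by (simp add: M_subspace_def)
  have "card V \<le> card (carrier_vec p :: bit vec set)"
    using left by (meson finite_carrier_vec_bit surj_card_le)
  then show ?thesis by (simp add: card_subspace_F2[OF sub] card_carrier_vec_bit)
next
  case (two_cosets b\<^sub>2 U)
  then show ?thesis using dim_annihilator_less[of U b\<^sub>2] by simp
qed

text \<open>This is a converse to the second case above, with first component zero for the extra
  coset. Second derivatives of \<phi> and \<open>h\<close> vanish because a direction is zero or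
  both equal \<open>b\<close>; the mixed terms vanish by \<open>perp\<close>.\<close>

lemma M_subspace_two_cosets:
  assumes U: "subspace_F2 p U" and b [simp]: "b \<in> carrier_vec q" and nz: "b \<noteq> 0\<^sub>v q"
    and perp: "\<And>u y. u \<in> U \<Longrightarrow> y \<in> carrier_vec q \<Longrightarrow> u \<bullet> derivative b \<phi> y = 0"
  defines "V \<equiv> {u @\<^sub>v c |u c. u \<in> U \<and> c \<in> {0\<^sub>v q, b}}"
  shows "M_subspace (p + q) f V" "dim_F2 (p + q) V = Suc (dim_F2 p U)"
proof -
  have Uc: "u \<in> carrier_vec p" if "u \<in> U" for u using U that by (auto simp: subspace_F2_iff)
  have add: "(u @\<^sub>v v) + (u' @\<^sub>v v') = (u + u') @\<^sub>v (v + v')"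
    if "u \<in> U" "u' \<in> U" "v \<in> carrier_vec q" "v' \<in> carrier_vec q"
    for u u' v v' :: "bit vec"
    using that Uc by (intro append_vec_add)
  have sub: "subspace_F2 (p + q) V"
    unfolding subspace_F2_iff
  proof (intro conjI ballI)
    show "V \<subseteq> carrier_vec (p + q)" using Uc by (auto simp: V_def)
    show "0\<^sub>v (p + q) \<in> V" using U zero_append_vec[where 'a = bit, of p q] by (auto simp: V_def subspace_F2_iff)
    fix v w assume "v \<in> V" "w \<in> V"
    then obtain u c u' c' where *: "v = u @\<^sub>v c" "u \<in> U" "c \<in> {0\<^sub>v q, b}"
      "w = u' @\<^sub>v c'" "u' \<in> U" "c' \<in> {0\<^sub>v q, b}" by (auto simp: V_def)
    then have "u + u' \<in> U" "c + c' \<in> {0\<^sub>v q, b}" "v + w = (u + u') @\<^sub>v (c + c')"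
      using U by (auto simp: subspace_F2_iff add bit_vec_add_self)
    then show "v + w \<in> V" by (auto simp: V_def)
  qed
  have perp': "u \<bullet> derivative c \<phi> y = 0" if "u \<in> U" "c \<in> {0\<^sub>v q, b}" "y \<in> carrier_vec q" for u c y
    using that perp Uc by (auto simp: derivative_vec_zero[of _ q _ p])
  have bb: "y + b + b = y" if "y \<in> carrier_vec q" for y
    using that by (rule vec_add_minus_F2) simp
  \<comment> \<open>Shifting twice by \<open>b\<close> returns to \<open>y\<close>, so each value of
    \<phi> is counted twice.\<close>
  have DDb: "derivative b (derivative b \<phi>) y = 0\<^sub>v p" if "y \<in> carrier_vec q" for y
  proof -
    have "\<phi> y + \<phi> (y + b) = \<phi> (y + b) + \<phi> y"
      using that by (intro comm_add_vec[of _ p]) auto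
    then show ?thesis
      unfolding derivative_def bb[OF that] using that
      by (simp add: bit_vec_add_self[of _ p] del: assoc_add_vec)
  qed
  have D\<phi>0: "derivative c (derivative (0\<^sub>v q) \<phi>) y = 0\<^sub>v p"
    if "c \<in> carrier_vec q" "y \<in> carrier_vec q" for c y
    using that by (simp add: derivative_def[of c] derivative_vec_zero[of _ q _ p])
  have D0\<phi>: "derivative (0\<^sub>v q) (derivative c \<phi>) y = 0\<^sub>v p"
    if "c \<in> carrier_vec q" "y \<in> carrier_vec q" for c y
    using that by (simp add: derivative_vec_zero[of _ q _ p])
  have DD\<phi>: "derivative c (derivative c' \<phi>) y = 0\<^sub>v p"
    if "c \<in> {0\<^sub>v q, b}" "c' \<in> {0\<^sub>v q, b}" "y \<in> carrier_vec q" for c c' y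
    using that DDb D\<phi>0 D0\<phi> by auto
  have DDbh: "derivative b (derivative b h) y = 0" if "y \<in> carrier_vec q" for y
    unfolding derivative_def bb[OF that] by (cases "h y"; cases "h (y + b)") simp_all
  have Dh0: "derivative c (derivative (0\<^sub>v q) h) y = 0"
    if "c \<in> carrier_vec q" "y \<in> carrier_vec q" for c y
    using that by (simp add: derivative_def[of c])
  have DDh: "derivative c (derivative c' h) y = 0"
    if "c \<in> {0\<^sub>v q, b}" "c' \<in> {0\<^sub>v q, b}" "y \<in> carrier_vec q" for c c' y
    using that DDbh Dh0 by auto
  show "M_subspace (p + q) f V"
    unfolding M_subspace_append_iff
  proof (intro conjI ballI sub)
    fix v w x y :: "bit vec"
    assume "v \<in> V" "w \<in> V" and [simp]: "x \<in> carrier_vec p" "y \<in> carrier_vec q"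
    then obtain u c u' c' where *: "v = u @\<^sub>v c" "u \<in> U" "c \<in> {0\<^sub>v q, b}"
      "w = u' @\<^sub>v c'" "u' \<in> U" "c' \<in> {0\<^sub>v q, b}" by (auto simp: V_def)
    then have [simp]: "c \<in> carrier_vec q" "c' \<in> carrier_vec q" by auto
    show "derivative v (derivative w f) (x @\<^sub>v y) = 0"
      unfolding *(1,4) using Uc[OF *(2)] Uc[OF *(5)]
      by (simp add: second_derivative DD\<phi>[OF *(3,6)] DDh[OF *(3,6)]
          perp'[OF *(2,6)] perp'[OF *(5,3)])
  qed
  have "V = (\<lambda>(u, c). u @\<^sub>v c) ` (U \<times> {0\<^sub>v q, b})" by (auto simp: V_def)
  moreover have "inj_on (\<lambda>(u, c). u @\<^sub>v c) (U \<times> {0\<^sub>v q, b})"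
    using Uc by (auto simp: inj_on_def append_vec_eq[of _ p])
  ultimately have "card V = card U * 2"
    using nz by (simp add: card_image card_cartesian_product)
  then show "dim_F2 (p + q) V = Suc (dim_F2 p U)"
    by (intro dim_F2_eqI[OF sub]) (simp add: card_subspace_F2[OF U])
qed

text \<open>A pair \<open>b\<close>, \<open>U\<close> yields a second subspace of dimension
  \<open>p\<close>, which contains \<open>(0, b)\<close>; conversely, a competitor cannot lie in the
  standard one and so produces such a pair. Writing \<open>Suc\<close> avoids truncated subtraction
  at \<open>p = 0\<close>.\<close>

lemma unique_maximal_M_subspace_iff:
  "{V. M_subspace (p + q) f V \<and> dim_F2 (p + q) V = p}
      = {(\<lambda>x. x @\<^sub>v 0\<^sub>v q) ` carrier_vec p} \<longleftrightarrow>
    \<not> (\<exists>b\<in>carrier_vec q. \<exists>U. b \<noteq> 0\<^sub>v q \<and> subspace_F2 p U \<and> Suc (dim_F2 p U) = p \<and>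
        (\<forall>u\<in>U. \<forall>y\<in>carrier_vec q. u \<bullet> derivative b \<phi> y = 0))"
  (is "?L = {?E} \<longleftrightarrow> \<not> ?R")
proof
  assume L: "?L = {?E}"
  show "\<not> ?R"
  proof
    assume ?R
    then obtain b U where b: "b \<in> carrier_vec q" "b \<noteq> 0\<^sub>v q"
      and U: "subspace_F2 p U" "Suc (dim_F2 p U) = p"
      "\<And>u y. u \<in> U \<Longrightarrow> y \<in> carrier_vec q \<Longrightarrow> u \<bullet> derivative b \<phi> y = 0" by blast
    let ?V = "{u @\<^sub>v c |u c. u \<in> U \<and> c \<in> {0\<^sub>v q, b}}"
    have "?V \<in> ?L"
      using M_subspace_two_cosets[OF U(1) b U(3)] U(2) by simp
    then have "?V = ?E" unfolding L by (rule singletonD)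
    moreover have "0\<^sub>v p @\<^sub>v b \<in> ?V"
      using U(1) by (auto simp: subspace_F2_iff)
    ultimately have "0\<^sub>v p @\<^sub>v b \<in> ?E" by simp
    then show False
      using b by (auto simp: append_vec_eq[of _ p])
  qed
next
  assume R: "\<not> ?R"
  have "V = ?E" if V: "M_subspace (p + q) f V" "dim_F2 (p + q) V = p" for V
    using V(1)
  proof (cases rule: M_subspace_cases)
    case left
    have sub: "subspace_F2 (p + q) V" using V by (simp add: M_subspace_def)
    \<comment> \<open>With \<open>V\<close> inside \<open>?E\<close>, this count forces
      equality.\<close>
    have "card ?E \<le> card V"
      using card_image_le[OF finite_carrier_vec_bit, of "\<lambda>x. x @\<^sub>v 0\<^sub>v q" p] V(2)
      by (simp add: card_subspace_F2[OF sub] card_carrier_vec_bit)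
    then show ?thesis
      using left by (intro card_seteq) auto
  next
    case (two_cosets b\<^sub>2 U)
    then show ?thesis using R V(2) by metis
  qed
  then show "?L = {?E}" using M_subspace_left by blast
qed

end

section \<open>The completed Maiorana-McFarland class\<close>

text \<open>Second derivatives kill the added affine part and turn the substitution into directions:
  those of \<open>F\<close> along \<open>u\<close>, \<open>v\<close> are those of \<open>f\<close>
  along \<open>B u\<close>, \<open>B v\<close>, where \<open>B\<close> is the transpose of
  \<open>A\<close>. Hence the preimage under \<open>B\<close> of the standard subspace
  works.\<close>

lemma MM_completed_M_subspace:
  assumes "F \<in> MM_completed m"
  shows "\<exists>V. M_subspace (2 * m) F V \<and> dim_F2 (2 * m) V = m"
proof -
  obtain f A b c d where f: "f \<in> MM_class m" and A: "A \<in> carrier_mat (2 * m) (2 * m)"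
    and inv: "invertible_mat A" and [simp]: "b \<in> carrier_vec (2 * m)" "c \<in> carrier_vec (2 * m)"
    and F: "\<And>z. z \<in> carrier_vec (2 * m) \<Longrightarrow> F z = f (transpose_mat A *\<^sub>v z + b) + c \<bullet> z + d"
    using assms unfolding MM_completed_def by blast
  obtain \<pi> g where \<pi>: "bij_betw \<pi> (carrier_vec m) (carrier_vec m)"
    and f_eq: "\<forall>x\<in>carrier_vec m. \<forall>y\<in>carrier_vec m. f (x @\<^sub>v y) = x \<bullet> \<pi> y + g y"
    using f unfolding MM_class_def by blast
  interpret affine_first_block m m \<pi> g f
    using \<pi> f_eq by unfold_locales (auto dest: bij_betwE)
  define E where "E = (\<lambda>x. x @\<^sub>v 0\<^sub>v m) ` (carrier_vec m :: bit vec set)"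
  have E: "M_subspace (2 * m) f E" "dim_F2 (2 * m) E = m"
    using M_subspace_left unfolding E_def mult_2 .
  then have subE: "subspace_F2 (2 * m) E" by (simp add: M_subspace_def)
  define B where "B = transpose_mat A"
  have B [simp]: "B \<in> carrier_mat (2 * m) (2 * m)" using A by (simp add: B_def)
  obtain C where C: "inverts_mat A C" "inverts_mat C A"
    using inv unfolding invertible_mat_def by blast
  have AC: "A * C = 1\<^sub>m (2 * m)" using C(1) A by (simp add: inverts_mat_def)
  \<comment> \<open>The size of \<open>C\<close> is not part of \<open>inverts_mat\<close>; it is
    read off from the two products.\<close>
  then have "C \<in> carrier_mat (2 * m) (2 * m)"
    using C(2) A unfolding inverts_mat_def
    by (metis carrier_matD carrier_matI index_mult_mat(2,3) index_one_mat(2,3))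
  define T where "T = transpose_mat C"
  have T [simp]: "T \<in> carrier_mat (2 * m) (2 * m)"
    using \<open>C \<in> _\<close> by (simp add: T_def)
  have CA: "C * A = 1\<^sub>m (2 * m)"
    using C(2) \<open>C \<in> _\<close> by (simp add: inverts_mat_def)
  have BT: "B * T = 1\<^sub>m (2 * m)"
    using transpose_mult[of C "2 * m" "2 * m" A "2 * m"] \<open>C \<in> _\<close> A CA by (simp add: B_def T_def)
  have BTv: "B *\<^sub>v (T *\<^sub>v z) = z" if "z \<in> carrier_vec (2 * m)" for z
    using that BT assoc_mult_mat_vec[of B "2 * m" "2 * m" T "2 * m" z] by simp
  have Ec: "E \<subseteq> carrier_vec (2 * m)" using subE by (simp add: subspace_F2_iff)
  \<comment> \<open>Since \<open>T\<close> inverts \<open>B\<close>, this image under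
    \<open>T\<close> is the preimage of \<open>E\<close> under \<open>B\<close>.\<close>
  define V where "V = (\<lambda>e. T *\<^sub>v e) ` E"
  have subV: "subspace_F2 (2 * m) V"
    unfolding subspace_F2_iff
  proof (intro conjI ballI)
    show "V \<subseteq> carrier_vec (2 * m)" using Ec mult_mat_vec_carrier[OF T] by (auto simp: V_def)
    have "T *\<^sub>v 0\<^sub>v (2 * m) = 0\<^sub>v (2 * m)"
      using carrier_matD[OF T] by (intro eq_vecI) auto
    then show "0\<^sub>v (2 * m) \<in> V" using subE unfolding V_def subspace_F2_iff by (metis image_eqI)
    fix v w assume "v \<in> V" "w \<in> V"
    then obtain a e where "a \<in> E" "e \<in> E" "v = T *\<^sub>v a" "w = T *\<^sub>v e" by (auto simp: V_def)
    moreover from \<open>a \<in> E\<close> \<open>e \<in> E\<close> have "a + e \<in> E" using subE unfolding subspace_F2_iff by blast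
    ultimately show "v + w \<in> V"
      using mult_add_distrib_mat_vec[OF T, of a e] Ec unfolding V_def by (metis image_eqI subsetD)
  qed
  have "inj_on (\<lambda>e. T *\<^sub>v e) E"
    using BTv Ec by (intro inj_on_inverseI[of _ "\<lambda>z. B *\<^sub>v z"]) auto
  then have "card V = card E" by (simp add: V_def card_image)
  then have dimV: "dim_F2 (2 * m) V = m"
    by (intro dim_F2_eqI[OF subV]) (simp add: card_subspace_F2[OF subE] E(2))
  have "derivative u (derivative v F) z = 0"
    if "u \<in> V" "v \<in> V" and [simp]: "z \<in> carrier_vec (2 * m)" for u v z
  proof -
    have [simp]: "u \<in> carrier_vec (2 * m)" "v \<in> carrier_vec (2 * m)"
      using that subV by (auto simp: subspace_F2_iff)
    have BE: "B *\<^sub>v u \<in> E" "B *\<^sub>v v \<in> E"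
      using that BTv Ec by (auto simp: V_def subset_iff)
    \<comment> \<open>The translation by \<open>b\<close> only moves the base point; directions
      transform linearly.\<close>
    have shift: "B *\<^sub>v (x + y) + b = (B *\<^sub>v x + b) + B *\<^sub>v y"
      if "x \<in> carrier_vec (2 * m)" "y \<in> carrier_vec (2 * m)" for x y
      using that mult_mat_vec_carrier[OF B] mult_add_distrib_mat_vec[OF B that]
      by (simp add: assoc_add_vec[of _ "2 * m"] comm_add_vec[of b "2 * m"])
    have cancel: "e + e = 0" "e + (e + e') = e'" for e e' :: bit
      by (cases e; cases e'; simp)+
    have "derivative u (derivative v F) z =
        derivative (B *\<^sub>v u) (derivative (B *\<^sub>v v) f) (B *\<^sub>v z + b)"
      by (simp add: derivative_def F shift scalar_prod_add_distrib[of _ "2 * m"] cancel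
          add.assoc add.commute add.left_commute flip: B_def del: assoc_add_vec)
    also have "\<dots> = 0"
      using E(1) BE mult_mat_vec_carrier[OF B, of z] by (simp add: M_subspace_def)
    finally show ?thesis .
  qed
  then have "M_subspace (2 * m) F V" using subV by (simp add: M_subspace_def)
  with dimV show ?thesis by blast
qed

theorem theorem5p3:
  fixes m k :: nat
    and \<phi> :: "bit vec \<Rightarrow> bit vec"
    and h f :: "bit vec \<Rightarrow> bit"
  assumes "0 < k" and "k < m"
    and "\<phi> \<in> carrier_vec (m + k) \<rightarrow> carrier_vec (m - k)"
    and "\<forall>v\<in>carrier_vec (m + k). \<forall>w\<in>carrier_vec (m + k). lin_indpt_pair (m + k) v w \<longrightarrow>
           (\<exists>y\<in>carrier_vec (m + k). derivative v (derivative w \<phi>) y \<noteq> 0\<^sub>v (m - k))"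
    and "\<forall>x\<in>carrier_vec (m - k). \<forall>y\<in>carrier_vec (m + k). f (x @\<^sub>v y) = x \<bullet> \<phi> y + h y"
  shows "(\<forall>V. M_subspace (2 * m) f V \<longrightarrow> dim_F2 (2 * m) V \<le> m - k) \<and>
    ({V. M_subspace (2 * m) f V \<and> dim_F2 (2 * m) V = m - k}
        = {{x @\<^sub>v 0\<^sub>v (m + k) |x. x \<in> carrier_vec (m - k)}} \<longleftrightarrow>
      \<not> (\<exists>b\<^sub>2\<in>carrier_vec (m + k). \<exists>U.
            b\<^sub>2 \<noteq> 0\<^sub>v (m + k) \<and> subspace_F2 (m - k) U \<and> dim_F2 (m - k) U = m - k - 1 \<and>
            (\<forall>u\<in>U. \<forall>y\<in>carrier_vec (m + k). u \<bullet> derivative b\<^sub>2 \<phi> y = 0))) \<and>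
    (bent (2 * m) f \<longrightarrow> f \<notin> MM_completed m)"
proof -
  interpret independent_second_derivatives "m - k" "m + k" \<phi> h f
    using assms by unfold_locales auto
  have n: "m - k + (m + k) = 2 * m" using assms(2) by simp
  have bound: "dim_F2 (2 * m) V \<le> m - k" if "M_subspace (2 * m) f V" for V
    using dim_M_subspace_le that unfolding n by blast
  \<comment> \<open>Here \<open>k < m\<close> makes \<open>m - k\<close> positive, so the
    subtraction of 1 is exact.\<close>
  have suc: "Suc i = m - k \<longleftrightarrow> i = m - k - 1" for i using assms(2) by auto
  have img: "(\<lambda>x. x @\<^sub>v 0\<^sub>v (m + k)) ` carrier_vec (m - k)
      = {x @\<^sub>v 0\<^sub>v (m + k) |x. x \<in> carrier_vec (m - k)}" by blast
  \<comment> \<open>Membership would give dimension \<open>m\<close>, above the bound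
    \<open>m - k\<close> since \<open>k\<close> is positive.\<close>
  have "f \<notin> MM_completed m"
    using MM_completed_M_subspace[of f m] bound assms(1,2) by fastforce
  with bound unique_maximal_M_subspace_iff[unfolded n suc img] show ?thesis
    by (intro conjI allI impI)
qed

end
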